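(* Let $p\in\mathbb{R}[x_1,\dots,x_n]$ be a homogeneous symmetric polynomial of degree $3$ with $p(\vec 1)\ne 0$, and let $u\in\mathbb{R}^n$ be any coordinate (standard basis) vector. Then $p$ is symmetric hyperbolic if and only if the univariate polynomial $p(u+t\vec 1)$ in $t$ has only real roots.
   Context: $\vec 1=(1,\dots,1)\in\mathbb{R}^n$. A homogeneous $p\in\mathbb{R}[x_1,\dots,x_n]$ is hyperbolic with respect to $v\in\mathbb{R}^n$ if $p(v)\ne0$ and for every $x\in\mathbb{R}^n$ the univariate polynomial $p(x+tv)$ in $t$ has only real roots. $p$ is symmetric hyperbolic if it is invariant under all permutations of the variables and hyperbolic with respect to $\vec 1$. *)

theory Defs
  imports
    "HOL-Analysis.Analysis"
    "HOL-Library.Poly_Mapping"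
    "HOL-Computational_Algebra.Polynomial"
begin

text \<open>
  Polynomials with coefficients in \<open>'a\<close> and variables indexed by the type \<open>'n\<close>, as finitely
  supported coefficient functions on monomials; a monomial is a finitely supported exponent vector.
  Addition and multiplication are the (convolution) operations of \<^theory>\<open>HOL-Library.Poly_Mapping\<close>.
\<close>

type_synonym ('n, 'a) mpoly = "('n \<Rightarrow>\<^sub>0 nat) \<Rightarrow>\<^sub>0 'a"

definition mconst :: "'a \<Rightarrow> ('n, 'a::zero) mpoly"
  where "mconst c = Poly_Mapping.single 0 c"

definition mvar :: "'n \<Rightarrow> ('n, 'a::zero_neq_one) mpoly"
  where "mvar i = Poly_Mapping.single (Poly_Mapping.single i 1) 1"

text \<open>
  Substitution of \<open>f i\<close> for the \<open>i\<close>-th variable, where \<open>h\<close> embeds the coefficients into the target ring.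
\<close>

definition msubst :: "('a \<Rightarrow> 'b) \<Rightarrow> ('n \<Rightarrow> 'b) \<Rightarrow> ('n::finite, 'a::zero) mpoly \<Rightarrow> 'b::comm_semiring_1"
  where "msubst h f p =
    (\<Sum>m\<in>Poly_Mapping.keys p. h (Poly_Mapping.lookup p m) * (\<Prod>i\<in>UNIV. f i ^ Poly_Mapping.lookup m i))"

definition mpoly_eval :: "('n::finite, real) mpoly \<Rightarrow> real ^ 'n \<Rightarrow> real"
  where "mpoly_eval p x = msubst (\<lambda>c. c) (\<lambda>i. x $ i) p"

text \<open>The univariate polynomial \<open>p(x + t v)\<close> in the indeterminate \<open>t\<close>.\<close>

definition line_poly :: "('n::finite, real) mpoly \<Rightarrow> real ^ 'n \<Rightarrow> real ^ 'n \<Rightarrow> real poly"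
  where "line_poly p x v = msubst (\<lambda>c. [:c:]) (\<lambda>i. [:x $ i, v $ i:]) p"

lemma poly_line_poly: "poly (line_poly p x v) t = mpoly_eval p (x + t *\<^sub>R v)"
  by (simp add: line_poly_def mpoly_eval_def msubst_def poly_sum poly_prod)

definition permute_vars :: "('n \<Rightarrow> 'n) \<Rightarrow> ('n::finite, 'a::comm_semiring_1) mpoly \<Rightarrow> ('n, 'a) mpoly"
  where "permute_vars \<pi> p = msubst mconst (\<lambda>i. mvar (\<pi> i)) p"

definition symmetric_mpoly :: "('n::finite, 'a::comm_semiring_1) mpoly \<Rightarrow> bool"
  where "symmetric_mpoly p \<longleftrightarrow> (\<forall>\<pi>. bij \<pi> \<longrightarrow> permute_vars \<pi> p = p)"

text \<open>The zero polynomial is homogeneous of every degree.\<close>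

definition homogeneous_mpoly :: "nat \<Rightarrow> ('n::finite, 'a::zero) mpoly \<Rightarrow> bool"
  where "homogeneous_mpoly d p \<longleftrightarrow>
    (\<forall>m\<in>Poly_Mapping.keys p. (\<Sum>i\<in>UNIV. Poly_Mapping.lookup m i) = d)"

definition only_real_roots :: "real poly \<Rightarrow> bool"
  where "only_real_roots q \<longleftrightarrow> (\<forall>z::complex. poly (map_poly complex_of_real q) z = 0 \<longrightarrow> z \<in> \<real>)"

definition hyperbolic :: "('n::finite, real) mpoly \<Rightarrow> real ^ 'n \<Rightarrow> bool"
  where "hyperbolic p v \<longleftrightarrow>
    (\<exists>d. homogeneous_mpoly d p) \<and> mpoly_eval p v \<noteq> 0 \<and> (\<forall>x. only_real_roots (line_poly p x v))"

definition ones :: "real ^ 'n"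
  where "ones = (\<chi> i. 1)"

definition symmetric_hyperbolic :: "('n::finite, real) mpoly \<Rightarrow> bool"
  where "symmetric_hyperbolic p \<longleftrightarrow> symmetric_mpoly p \<and> hyperbolic p ones"

end

theory Submission imports Defs
begin

text \<open>
  A symmetric cubic form is a combination \<open>a P\<^sub>1\<^sup>3 + b P\<^sub>1 P\<^sub>2 + c P\<^sub>3\<close> of power sums. Writing
  \<open>x = s \<cdot> 1 + y\<close> with \<open>y\<close> of coordinate sum \<open>0\<close>, the restriction of \<open>p\<close> to the line through \<open>x\<close>
  becomes a depressed cubic in \<open>t + s\<close> with coefficients \<open>A\<close>, \<open>B \<Sum>y\<^sub>i\<^sup>2\<close> and \<open>c \<Sum>y\<^sub>i\<^sup>3\<close>. By its
  discriminant, real-rootedness depends only on the ratio of \<open>(\<Sum>y\<^sub>i\<^sup>3)\<^sup>2\<close> to \<open>(\<Sum>y\<^sub>i\<^sup>2)\<^sup>3\<close>, and this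
  ratio is largest for the projection of a coordinate vector.
\<close>

section \<open>Symmetric cubic forms\<close>

text \<open>Written as a sum of singles because this is the exponent that arises when
  \<open>permute_vars\<close> multiplies out powers of the variables \<open>\<pi> i\<close>.\<close>

definition permute_exps :: "('n \<Rightarrow> 'n) \<Rightarrow> ('n::finite \<Rightarrow>\<^sub>0 nat) \<Rightarrow> ('n \<Rightarrow>\<^sub>0 nat)"
  where "permute_exps \<pi> m = (\<Sum>i\<in>UNIV. Poly_Mapping.single (\<pi> i) (Poly_Mapping.lookup m i))"

lemma lookup_permute_exps:
  assumes "bij \<pi>"
  shows "Poly_Mapping.lookup (permute_exps \<pi> m) (\<pi> j) = Poly_Mapping.lookup m j"
proof -
  have "\<And>i. \<pi> i = \<pi> j \<longleftrightarrow> i = j"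
    using assms by (auto simp: bij_def inj_def)
  then show ?thesis
    by (simp add: permute_exps_def lookup_sum lookup_single when_def)
qed

lemma inj_permute_exps:
  assumes "bij \<pi>"
  shows "inj (permute_exps \<pi>)"
  by (metis assms injI lookup_permute_exps poly_mapping_eqI)

lemma permute_exps_add: "permute_exps \<pi> (m + m') = permute_exps \<pi> m + permute_exps \<pi> m'"
  by (simp add: permute_exps_def lookup_add single_add sum.distrib)

lemma permute_exps_single:
  fixes i :: "'n::finite"
  shows "permute_exps \<pi> (Poly_Mapping.single i k) = Poly_Mapping.single (\<pi> i) k"
proof -
  have "permute_exps \<pi> (Poly_Mapping.single i k)
      = (\<Sum>j\<in>UNIV. if j = i then Poly_Mapping.single (\<pi> i) k else 0)"
    unfolding permute_exps_def by (rule sum.cong) (auto simp: lookup_single when_def)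
  then show ?thesis by simp
qed

lemma mvar_power:
  "(mvar i :: ('n, 'a::comm_semiring_1) mpoly) ^ k = Poly_Mapping.single (Poly_Mapping.single i k) 1"
  by (induction k) (auto simp: mvar_def mult_single single_add[symmetric] simp flip: single_one)

lemma prod_single:
  "(\<Prod>i\<in>A. Poly_Mapping.single (f i) 1 :: ('n, 'a::comm_semiring_1) mpoly)
    = Poly_Mapping.single (\<Sum>i\<in>A. f i) 1"
  by (induction A rule: infinite_finite_induct) (auto simp: mult_single simp flip: single_one)

lemma permute_vars_eq:
  "permute_vars \<pi> p
    = (\<Sum>m\<in>Poly_Mapping.keys p. Poly_Mapping.single (permute_exps \<pi> m) (Poly_Mapping.lookup p m))"
  by (simp add: permute_vars_def msubst_def mconst_def mvar_power prod_single mult_single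
      permute_exps_def)

text \<open>As \<open>permute_exps \<pi>\<close> is injective, no two monomials collide in
  \<open>permute_vars_eq\<close>. For symmetric \<open>p\<close>, coefficients are therefore
  constant on orbits of monomials.\<close>

lemma lookup_permute_vars:
  assumes "bij \<pi>"
  shows "Poly_Mapping.lookup (permute_vars \<pi> p) (permute_exps \<pi> m) = Poly_Mapping.lookup p m"
proof -
  have "\<And>m'. permute_exps \<pi> m' = permute_exps \<pi> m \<longleftrightarrow> m' = m"
    using inj_permute_exps[OF assms] by (auto simp: inj_def)
  then show ?thesis
    by (simp add: permute_vars_eq lookup_sum lookup_single when_def in_keys_iff)
qed

section \<open>Cubic monomials as index triples\<close>

definition mon3 :: "'n \<times> 'n \<times> 'n \<Rightarrow> ('n \<Rightarrow>\<^sub>0 nat)"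
  where "mon3 = (\<lambda>(i, j, k). Poly_Mapping.single i 1 + Poly_Mapping.single j 1 + Poly_Mapping.single k 1)"

lemma permute_exps_mon3:
  fixes \<pi> :: "'n::finite \<Rightarrow> 'n"
  shows "permute_exps \<pi> (mon3 (i, j, k)) = mon3 (\<pi> i, \<pi> j, \<pi> k)"
  by (simp add: mon3_def permute_exps_add permute_exps_single)

lemma exps_of_degree_Suc:
  fixes m :: "'n::finite \<Rightarrow>\<^sub>0 nat"
  assumes "(\<Sum>i\<in>UNIV. Poly_Mapping.lookup m i) = Suc d"
  obtains i m' where "m = m' + Poly_Mapping.single i 1" "(\<Sum>i\<in>UNIV. Poly_Mapping.lookup m' i) = d"
proof -
  obtain i where i: "Poly_Mapping.lookup m i \<noteq> 0"
    using assms by (metis Zero_not_Suc sum.neutral)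
  \<comment> \<open>The subtraction is truncated, which is harmless as the exponent of
    \<open>i\<close> is positive.\<close>
  define m' where "m' = m - Poly_Mapping.single i 1"
  have m: "m = m' + Poly_Mapping.single i 1"
    using i by (intro poly_mapping_eqI) (auto simp: m'_def lookup_add lookup_minus lookup_single when_def)
  have "(\<Sum>j\<in>UNIV. Poly_Mapping.lookup m j) = (\<Sum>j\<in>UNIV. Poly_Mapping.lookup m' j) + 1"
    by (subst m) (simp add: lookup_add sum.distrib lookup_single when_def)
  with assms m that show thesis by simp
qed

lemma exps_of_degree_3:
  fixes m :: "'n::finite \<Rightarrow>\<^sub>0 nat"
  assumes "(\<Sum>i\<in>UNIV. Poly_Mapping.lookup m i) = 3"
  shows "m \<in> range mon3"
proof -
  obtain i m1 where 1: "m = m1 + Poly_Mapping.single i 1" "(\<Sum>i\<in>UNIV. Poly_Mapping.lookup m1 i) = 2"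
    by (rule exps_of_degree_Suc[of m 2]) (simp add: assms)
  obtain j m2 where 2: "m1 = m2 + Poly_Mapping.single j 1" "(\<Sum>i\<in>UNIV. Poly_Mapping.lookup m2 i) = 1"
    by (rule exps_of_degree_Suc[of m1 1]) (simp add: 1(2))
  obtain k m3 where 3: "m2 = m3 + Poly_Mapping.single k 1" "(\<Sum>i\<in>UNIV. Poly_Mapping.lookup m3 i) = 0"
    by (rule exps_of_degree_Suc[of m2 0]) (simp add: 2(2))
  have "m3 = 0" using 3(2) by (intro poly_mapping_eqI) simp
  then have "m = mon3 (k, j, i)" using 1(1) 2(1) 3(1) by (simp add: mon3_def)
  then show ?thesis by blast
qed

lemma prod_power_single:
  fixes x :: "'n::finite \<Rightarrow> 'a::comm_semiring_1"
  shows "(\<Prod>l\<in>UNIV. x l ^ Poly_Mapping.lookup (Poly_Mapping.single i 1) l) = x i"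
proof -
  have "(\<Prod>l\<in>UNIV. x l ^ Poly_Mapping.lookup (Poly_Mapping.single i 1) l)
      = (\<Prod>l\<in>UNIV. if l = i then x i else 1)"
    by (rule prod.cong) (auto simp: lookup_single when_def)
  then show ?thesis by simp
qed

lemma prod_power_mon3:
  fixes x :: "'n::finite \<Rightarrow> 'a::comm_semiring_1"
  shows "(\<Prod>l\<in>UNIV. x l ^ Poly_Mapping.lookup (mon3 (i, j, k)) l) = x i * x j * x k"
  unfolding mon3_def by (simp only: case_prod_conv lookup_add power_add prod.distrib prod_power_single)

text \<open>
  The division spreads the coefficient of a monomial evenly over all index triples that yield it,
  which makes the coefficients of the trilinear form symmetric.
\<close>

definition trilin :: "('n::finite, real) mpoly \<Rightarrow> 'n \<Rightarrow> 'n \<Rightarrow> 'n \<Rightarrow> real"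
  where "trilin p i j k =
    Poly_Mapping.lookup p (mon3 (i, j, k)) / card {t. mon3 t = mon3 (i, j, k)}"

text \<open>Group the triples by their monomial: each fibre of \<open>mon3\<close> has as many equal
  summands as the divisor in \<open>trilin\<close>, so exactly one copy of each term of
  \<open>p\<close> survives.\<close>

lemma mpoly_eval_trilin:
  fixes p :: "('n::finite, real) mpoly"
  assumes "homogeneous_mpoly 3 p"
  shows "mpoly_eval p x = (\<Sum>i\<in>UNIV. \<Sum>j\<in>UNIV. \<Sum>k\<in>UNIV. trilin p i j k * (x $ i * x $ j * x $ k))"
proof -
  define g where "g m = Poly_Mapping.lookup p m * (\<Prod>l\<in>UNIV. (x $ l) ^ Poly_Mapping.lookup m l)" for m
  have keys: "Poly_Mapping.keys p \<subseteq> range mon3"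
    using assms exps_of_degree_3 by (auto simp: homogeneous_mpoly_def)
  have "(\<Sum>i\<in>UNIV. \<Sum>j\<in>UNIV. \<Sum>k\<in>UNIV. trilin p i j k * (x $ i * x $ j * x $ k))
      = (\<Sum>(i, j, k)\<in>UNIV. trilin p i j k * (x $ i * x $ j * x $ k))"
    by (simp add: sum.cartesian_product)
  also have "\<dots> = (\<Sum>t\<in>UNIV. g (mon3 t) / card {t'. mon3 t' = mon3 t})"
    by (intro sum.cong) (auto simp: g_def trilin_def prod_power_mon3)
  also have "\<dots> = (\<Sum>m\<in>range mon3. \<Sum>t\<in>{t\<in>UNIV. mon3 t = m}. g (mon3 t) / card {t'. mon3 t' = mon3 t})"
    by (rule sum.image_gen) simp
  also have "\<dots> = (\<Sum>m\<in>range mon3. g m)"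
  proof (rule sum.cong[OF refl])
    fix m :: "'n \<Rightarrow>\<^sub>0 nat" assume "m \<in> range mon3"
    then have "card {t. mon3 t = m} \<noteq> 0" by (auto simp: card_eq_0_iff)
    then show "(\<Sum>t\<in>{t\<in>UNIV. mon3 t = m}. g (mon3 t) / card {t'. mon3 t' = mon3 t}) = g m" by simp
  qed
  also have "\<dots> = (\<Sum>m\<in>Poly_Mapping.keys p. g m)"
    using keys by (intro sum.mono_neutral_right) (auto simp: g_def in_keys_iff)
  also have "\<dots> = mpoly_eval p x"
    by (simp add: mpoly_eval_def msubst_def g_def)
  finally show ?thesis by simp
qed

text \<open>The numerator is invariant by symmetry of \<open>p\<close>, the denominator because
  \<open>\<pi>\<close>, applied to all three entries, maps one fibre of \<open>mon3\<close>
  bijectively onto the other.\<close>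

lemma trilin_permute:
  assumes "symmetric_mpoly p" "bij \<pi>"
  shows "trilin p (\<pi> i) (\<pi> j) (\<pi> k) = trilin p i j k"
proof -
  have "bij_betw (map_prod \<pi> (map_prod \<pi> \<pi>)) {t. mon3 t = mon3 (i, j, k)} {t. mon3 t = mon3 (\<pi> i, \<pi> j, \<pi> k)}"
    unfolding bij_betw_def
  proof
    have inj: "inj \<pi>" and surj: "surj \<pi>" using assms(2) by (auto simp: bij_def)
    show "inj_on (map_prod \<pi> (map_prod \<pi> \<pi>)) {t. mon3 t = mon3 (i, j, k)}"
      using inj by (auto simp: inj_on_def)
    have eq: "mon3 (\<pi> a, \<pi> b, \<pi> c) = mon3 (\<pi> i, \<pi> j, \<pi> k) \<longleftrightarrow> mon3 (a, b, c) = mon3 (i, j, k)" for a b c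
      using inj_permute_exps[OF assms(2)] by (simp add: inj_eq flip: permute_exps_mon3)
    show "map_prod \<pi> (map_prod \<pi> \<pi>) ` {t. mon3 t = mon3 (i, j, k)} = {t. mon3 t = mon3 (\<pi> i, \<pi> j, \<pi> k)}"
    proof (intro equalityI subsetI)
      fix t assume t: "t \<in> {t. mon3 t = mon3 (\<pi> i, \<pi> j, \<pi> k)}"
      obtain a b c where "t = (\<pi> a, \<pi> b, \<pi> c)" using surj by (metis prod_cases3 surjD)
      with t eq show "t \<in> map_prod \<pi> (map_prod \<pi> \<pi>) ` {t. mon3 t = mon3 (i, j, k)}"
        by (intro image_eqI[of _ _ "(a, b, c)"]) auto
    qed (auto simp: eq)
  qed
  moreover have "Poly_Mapping.lookup p (mon3 (\<pi> i, \<pi> j, \<pi> k)) = Poly_Mapping.lookup p (mon3 (i, j, k))"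
    using assms lookup_permute_vars[OF assms(2), of p "mon3 (i, j, k)"]
    by (simp add: symmetric_mpoly_def permute_exps_mon3)
  ultimately show ?thesis
    by (simp add: trilin_def bij_betw_same_card)
qed

section \<open>Orbits of index triples\<close>

lemma trilin_commute:
  "trilin p i j k = trilin p j i k" "trilin p i j k = trilin p i k j"
  by (simp_all add: trilin_def mon3_def add_ac)

text \<open>Three successive transpositions put \<open>i\<close>, \<open>j\<close>, \<open>k\<close>
  in place; the matching equality patterns ensure that no later one moves an index already
  placed.\<close>

lemma ex_bij_triple:
  fixes i j k i' j' k' :: 'a
  assumes "i = j \<longleftrightarrow> i' = j'" "j = k \<longleftrightarrow> j' = k'" "i = k \<longleftrightarrow> i' = k'"
  obtains \<pi> where "bij \<pi>" "\<pi> i = i'" "\<pi> j = j'" "\<pi> k = k'"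
proof -
  define \<pi>1 where "\<pi>1 = Transposition.transpose i i'"
  define \<pi>2 where "\<pi>2 = Transposition.transpose (\<pi>1 j) j' \<circ> \<pi>1"
  define \<pi>3 where "\<pi>3 = Transposition.transpose (\<pi>2 k) k' \<circ> \<pi>2"
  have b1: "bij \<pi>1" unfolding \<pi>1_def by simp
  have b2: "bij \<pi>2" unfolding \<pi>2_def by (intro bij_comp b1) simp
  have b3: "bij \<pi>3" unfolding \<pi>3_def by (intro bij_comp b2) simp
  have inj: "\<pi>1 a = \<pi>1 b \<longleftrightarrow> a = b" "\<pi>2 a = \<pi>2 b \<longleftrightarrow> a = b" for a b
    using b1 b2 by (auto simp: bij_def inj_eq)
  have 1: "\<pi>1 i = i'" by (simp add: \<pi>1_def)
  have 2: "\<pi>2 i = i'" "\<pi>2 j = j'"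
    using 1 assms(1) inj(1)[of j i] by (auto simp: \<pi>2_def Transposition.transpose_def)
  have "\<pi>3 i = i'" "\<pi>3 j = j'" "\<pi>3 k = k'"
    using 2 assms inj(2)[of k i] inj(2)[of k j] by (auto simp: \<pi>3_def Transposition.transpose_def)
  with b3 that show thesis by blast
qed

text \<open>By \<open>ex_bij_triple\<close> only the equality pattern of the indices matters, which
  leaves at most three values. Indicators are used because they collapse triple sums to power
  sums.\<close>

lemma trilin_pattern:
  assumes "symmetric_mpoly p"
  obtains a b c where
    "\<And>i j k. trilin p i j k = c + b * (of_bool (i = j) + of_bool (j = k) + of_bool (i = k))
      + a * of_bool (i = j \<and> j = k)"
proof -
  let ?T = "trilin p"
  have inv: "?T i j k = ?T i' j' k'"
    if "i = j \<longleftrightarrow> i' = j'" "j = k \<longleftrightarrow> j' = k'" "i = k \<longleftrightarrow> i' = k'" for i j k i' j' k'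
    using ex_bij_triple[OF that] trilin_permute[OF assms] by metis
  obtain a where a: "\<And>i. ?T i i i = a" using inv by metis
  \<comment> \<open>With very few variables this pattern, or the next, does not occur; its value is
    then arbitrary.\<close>
  obtain b where b: "\<And>i j. i \<noteq> j \<Longrightarrow> ?T i i j = b"
    by (cases "\<exists>i j :: 'a. i \<noteq> j") (use inv in metis)+
  obtain c where c: "\<And>i j k. i \<noteq> j \<Longrightarrow> j \<noteq> k \<Longrightarrow> i \<noteq> k \<Longrightarrow> ?T i j k = c"
    by (cases "\<exists>i j k :: 'a. i \<noteq> j \<and> j \<noteq> k \<and> i \<noteq> k") (use inv in metis)+
  have b': "?T i j i = b" "?T j i i = b" if "i \<noteq> j" for i j
    using b[OF that] trilin_commute[of p] by metis+
  \<comment> \<open>The indicator sum is 1 when exactly two indices agree and 3 when all do; the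
    last coefficient corrects \<open>c + 3 * (b - c)\<close> to \<open>a\<close>.\<close>
  have "?T i j k = c + (b - c) * (of_bool (i = j) + of_bool (j = k) + of_bool (i = k))
      + (a - 3 * b + 2 * c) * of_bool (i = j \<and> j = k)" for i j k
    by (cases "i = j"; cases "j = k"; cases "i = k") (auto simp: a b b' c)
  then show thesis using that by blast
qed

proposition symmetric_cubic_power_sums:
  fixes p :: "('n::finite, real) mpoly"
  assumes "homogeneous_mpoly 3 p" "symmetric_mpoly p"
  obtains a b c where
    "\<And>x. mpoly_eval p x = a * (\<Sum>i\<in>UNIV. x $ i) ^ 3
      + b * (\<Sum>i\<in>UNIV. x $ i) * (\<Sum>i\<in>UNIV. (x $ i)\<^sup>2) + c * (\<Sum>i\<in>UNIV. (x $ i) ^ 3)"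
proof -
  obtain a b c where T: "\<And>i j k. trilin p i j k =
      c + b * (of_bool (i = j) + of_bool (j = k) + of_bool (i = k)) + a * of_bool (i = j \<and> j = k)"
    by (rule trilin_pattern[OF assms(2)]) (rule that)
  \<comment> \<open>The constant part of \<open>trilin\<close> gives the cube of the first power sum
    and the full diagonal the third power sum, so \<open>a\<close> and \<open>c\<close> change
    places. The 3 counts the pair indicators.\<close>
  have "mpoly_eval p x = c * (\<Sum>i\<in>UNIV. x $ i) ^ 3
      + (3 * b) * (\<Sum>i\<in>UNIV. x $ i) * (\<Sum>i\<in>UNIV. (x $ i)\<^sup>2) + a * (\<Sum>i\<in>UNIV. (x $ i) ^ 3)" for x
  proof -
    let ?S = "\<lambda>f. \<Sum>i\<in>UNIV. \<Sum>j\<in>UNIV. \<Sum>k\<in>UNIV. f i j k :: real"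
    let ?P1 = "\<Sum>i\<in>UNIV. x $ i" and ?P2 = "\<Sum>i\<in>UNIV. (x $ i)\<^sup>2"
    have 0: "?S (\<lambda>i j k. x $ i * x $ j * x $ k) = ?P1 ^ 3"
      by (simp add: power3_eq_cube sum_product sum_distrib_left sum_distrib_right mult_ac)
    have 1: "?S (\<lambda>i j k. of_bool (i = j) * (x $ i * x $ j * x $ k)) = ?P1 * ?P2"
    proof -
      have "?S (\<lambda>i j k. of_bool (i = j) * (x $ i * x $ j * x $ k))
          = (\<Sum>i\<in>UNIV. \<Sum>j\<in>UNIV. if j = i then (x $ i)\<^sup>2 * ?P1 else 0)"
        by (intro sum.cong) (auto simp: sum_distrib_left power2_eq_square)
      then show ?thesis by (simp add: sum_distrib_left mult.commute)
    qed
    have 2: "?S (\<lambda>i j k. of_bool (j = k) * (x $ i * x $ j * x $ k)) = ?P1 * ?P2"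
    proof -
      have "?S (\<lambda>i j k. of_bool (j = k) * (x $ i * x $ j * x $ k))
          = ?S (\<lambda>i j k. if k = j then x $ i * (x $ j)\<^sup>2 else 0)"
        by (intro sum.cong) (auto simp: power2_eq_square)
      then show ?thesis by (simp add: sum_product)
    qed
    have 3: "?S (\<lambda>i j k. of_bool (i = k) * (x $ i * x $ j * x $ k)) = ?P1 * ?P2"
    proof -
      have "?S (\<lambda>i j k. of_bool (i = k) * (x $ i * x $ j * x $ k))
          = ?S (\<lambda>i j k. if k = i then (x $ i)\<^sup>2 * x $ j else 0)"
        by (intro sum.cong) (auto simp: power2_eq_square)
      then have "?S (\<lambda>i j k. of_bool (i = k) * (x $ i * x $ j * x $ k)) = ?P2 * ?P1"
        by (simp add: sum_product)
      then show ?thesis by (simp only: mult.commute)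
    qed
    have 4: "?S (\<lambda>i j k. of_bool (i = j \<and> j = k) * (x $ i * x $ j * x $ k)) = (\<Sum>i\<in>UNIV. (x $ i) ^ 3)"
    proof -
      have "?S (\<lambda>i j k. of_bool (i = j \<and> j = k) * (x $ i * x $ j * x $ k))
          = ?S (\<lambda>i j k. if k = j then if j = i then (x $ i) ^ 3 else 0 else 0)"
        by (intro sum.cong) (auto simp: power3_eq_cube)
      then show ?thesis by simp
    qed
    have "mpoly_eval p x = ?S (\<lambda>i j k. c * (x $ i * x $ j * x $ k)
        + b * (of_bool (i = j) * (x $ i * x $ j * x $ k))
        + b * (of_bool (j = k) * (x $ i * x $ j * x $ k))
        + b * (of_bool (i = k) * (x $ i * x $ j * x $ k))
        + a * (of_bool (i = j \<and> j = k) * (x $ i * x $ j * x $ k)))"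
      unfolding mpoly_eval_trilin[OF assms(1)] T
      by (intro sum.cong refl) (simp add: algebra_simps)
    also have "\<dots> = c * ?P1 ^ 3 + b * (?P1 * ?P2) + b * (?P1 * ?P2) + b * (?P1 * ?P2)
        + a * (\<Sum>i\<in>UNIV. (x $ i) ^ 3)"
      unfolding sum.distrib sum_distrib_left[of a, symmetric] sum_distrib_left[of b, symmetric]
        sum_distrib_left[of c, symmetric] 0 1 2 3 4 ..
    finally show ?thesis by (simp add: algebra_simps)
  qed
  then show thesis using that by blast
qed

section \<open>Depressed cubics\<close>

lemma depressed_cubic_real_root:
  fixes p q :: real
  obtains r where "r ^ 3 + p * r + q = 0"
proof -
  \<comment> \<open>At \<open>M\<close> and \<open>- M\<close> the lower terms are at most
    \<open>M * M\<close> \<le> \<open>M ^ 3\<close> in absolute value, so the cubic term decides the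
    sign at both ends.\<close>
  define M where "M = 1 + \<bar>p\<bar> + \<bar>q\<bar>"
  have M: "M \<ge> 1" "M\<^sup>2 \<ge> M" by (auto simp: M_def power2_eq_square mult_le_cancel_left1)
  have key: "\<bar>p * M + q\<bar> \<le> M ^ 3" "\<bar>p * M - q\<bar> \<le> M ^ 3"
  proof -
    have "\<bar>p\<bar> * M + \<bar>q\<bar> \<le> \<bar>p\<bar> * M + \<bar>q\<bar> * M"
      using M by (simp add: mult_le_cancel_left1)
    also have "\<dots> \<le> M * M"
      using M by (simp add: M_def algebra_simps)
    also have "\<dots> \<le> M ^ 3"
      using M by (simp add: power3_eq_cube mult_le_cancel_left1)
    finally have "\<bar>p\<bar> * M + \<bar>q\<bar> \<le> M ^ 3" .
    moreover have "\<bar>p * M\<bar> = \<bar>p\<bar> * M" using M by (simp add: abs_mult)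
    ultimately show "\<bar>p * M + q\<bar> \<le> M ^ 3" "\<bar>p * M - q\<bar> \<le> M ^ 3" by linarith+
  qed
  have "\<exists>r\<ge>-M. r \<le> M \<and> r ^ 3 + p * r + q = 0"
  proof (rule IVT')
    show "(- M) ^ 3 + p * - M + q \<le> 0" "0 \<le> M ^ 3 + p * M + q" "- M \<le> M"
      using key M by (simp_all add: abs_le_iff)
    show "continuous_on {- M..M} (\<lambda>r. r ^ 3 + p * r + q)" by (intro continuous_intros)
  qed
  with that show thesis by blast
qed

lemma complex_quadratic_real_roots:
  fixes b c :: real
  shows "(\<forall>z::complex. z\<^sup>2 + b * z + c = 0 \<longrightarrow> z \<in> \<real>) \<longleftrightarrow> b\<^sup>2 - 4 * c \<ge> 0"
proof
  assume real: "\<forall>z::complex. z\<^sup>2 + b * z + c = 0 \<longrightarrow> z \<in> \<real>"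
  show "b\<^sup>2 - 4 * c \<ge> 0"
  proof (rule ccontr)
    assume "\<not> b\<^sup>2 - 4 * c \<ge> 0"
    then have s: "sqrt (4 * c - b\<^sup>2) > 0" "(sqrt (4 * c - b\<^sup>2))\<^sup>2 = 4 * c - b\<^sup>2" by auto
    define z where "z = Complex (- b / 2) (sqrt (4 * c - b\<^sup>2) / 2)"
    have "z\<^sup>2 + b * z + c = 0"
      using s(2) by (simp add: z_def complex_eq_iff power2_eq_square field_simps)
    with real have "z \<in> \<real>" by blast
    with s(1) show False by (simp add: z_def complex_is_Real_iff)
  qed
next
  assume disc: "b\<^sup>2 - 4 * c \<ge> 0"
  show "\<forall>z::complex. z\<^sup>2 + b * z + c = 0 \<longrightarrow> z \<in> \<real>"
  proof (intro allI impI)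
    fix z :: complex assume z: "z\<^sup>2 + b * z + c = 0"
    \<comment> \<open>The imaginary part forces a non-real root to have real part
      \<open>- b / 2\<close>; the real part then makes the discriminant
      \<open>- 4 * (Im z)\<^sup>2\<close>, which is negative.\<close>
    have re: "(Re z)\<^sup>2 - (Im z)\<^sup>2 + b * Re z + c = 0" and im: "(2 * Re z + b) * Im z = 0"
      using arg_cong[OF z, of Re] arg_cong[OF z, of Im] by (simp_all add: power2_eq_square algebra_simps)
    show "z \<in> \<real>"
    proof (rule ccontr)
      assume "z \<notin> \<real>"
      then have "Im z \<noteq> 0" by (simp add: complex_is_Real_iff)
      then have "b = - 2 * Re z" using im by simp
      then have "b\<^sup>2 - 4 * c = - 4 * (Im z)\<^sup>2" using re by (simp add: power2_eq_square algebra_simps)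
      with disc \<open>Im z \<noteq> 0\<close> show False by simp
    qed
  qed
qed

text \<open>
  With a real root \<open>r\<close>, the cofactor \<open>z\<^sup>2 + r z + (r\<^sup>2 + p)\<close> has discriminant \<open>- (4 p + 3 r\<^sup>2)\<close>, while
  \<open>4 p\<^sup>3 + 27 q\<^sup>2 = (4 p + 3 r\<^sup>2) (p + 3 r\<^sup>2)\<^sup>2\<close>.
\<close>

lemma depressed_cubic_real_roots_iff:
  fixes p q :: real
  shows "(\<forall>z::complex. z ^ 3 + p * z + q = 0 \<longrightarrow> z \<in> \<real>) \<longleftrightarrow> 4 * p ^ 3 + 27 * q\<^sup>2 \<le> 0"
proof -
  obtain r where r: "r ^ 3 + p * r + q = 0" by (rule depressed_cubic_real_root)
  then have q: "q = - (r ^ 3) - p * r" by simp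
  have fac: "z ^ 3 + p * z + q = (z - r) * (z\<^sup>2 + r * z + complex_of_real (r\<^sup>2 + p))" for z :: complex
    by (simp add: q power2_eq_square power3_eq_cube algebra_simps)
  have "(\<forall>z::complex. z ^ 3 + p * z + q = 0 \<longrightarrow> z \<in> \<real>)
      \<longleftrightarrow> (\<forall>z::complex. z\<^sup>2 + r * z + complex_of_real (r\<^sup>2 + p) = 0 \<longrightarrow> z \<in> \<real>)"
    unfolding fac by auto
  also have "\<dots> \<longleftrightarrow> 4 * p + 3 * r\<^sup>2 \<le> 0"
    unfolding complex_quadratic_real_roots by (auto simp: algebra_simps)
  \<comment> \<open>The square is positive unless \<open>p = - 3 * r\<^sup>2\<close>; in that case
    the first factor is \<open>- 9 * r\<^sup>2\<close> and both sides hold.\<close>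
  also have "\<dots> \<longleftrightarrow> (4 * p + 3 * r\<^sup>2) * (p + 3 * r\<^sup>2)\<^sup>2 \<le> 0"
  proof (cases "p + 3 * r\<^sup>2 = 0")
    case True
    then have p: "p = - 3 * r\<^sup>2" by simp
    show ?thesis by (simp add: p)
  next
    case False
    then show ?thesis by (simp add: mult_le_0_iff)
  qed
  also have "(4 * p + 3 * r\<^sup>2) * (p + 3 * r\<^sup>2)\<^sup>2 = 4 * p ^ 3 + 27 * q\<^sup>2"
    by (simp add: q power2_eq_square power3_eq_cube algebra_simps)
  finally show ?thesis .
qed

section \<open>Power sums of centred vectors\<close>

text \<open>Cauchy-Schwarz for the remaining coordinates, whose sum is \<open>- y i\<close>.\<close>

lemma centred_coordinate_bound:
  fixes y :: "'n \<Rightarrow> real"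
  assumes "finite I" "i \<in> I" "(\<Sum>j\<in>I. y j) = 0"
  shows "card I * (y i)\<^sup>2 \<le> (real (card I) - 1) * (\<Sum>j\<in>I. (y j)\<^sup>2)"
proof -
  have "(\<Sum>j\<in>I - {i}. y j) = - y i"
    using assms by (simp add: sum_diff1)
  then have "(y i)\<^sup>2 = (\<Sum>j\<in>I - {i}. y j)\<^sup>2" by simp
  also have "\<dots> \<le> (\<Sum>j\<in>I - {i}. (y j)\<^sup>2) * card (I - {i})"
    by (rule sum_squared_le_sum_of_squares)
  also have "real (card (I - {i})) = real (card I) - 1"
    using card.remove[OF assms(1,2)] by linarith
  also have "(\<Sum>j\<in>I - {i}. (y j)\<^sup>2) = (\<Sum>j\<in>I. (y j)\<^sup>2) - (y i)\<^sup>2"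
    using assms by (simp add: sum_diff1)
  finally show ?thesis
    by (simp add: algebra_simps)
qed

text \<open>
  Sum \<open>(m - y\<^sub>j) (y\<^sub>j + m / (n - 1))\<^sup>2 \<ge> 0\<close> over \<open>j\<close>, where \<open>m = sqrt ((n - 1) / n \<Sum>y\<^sub>j\<^sup>2)\<close> is the largest
  value a coordinate can take; each summand vanishes at the projections of the coordinate vectors.
\<close>

lemma centred_cube_sum_le:
  fixes y :: "'n \<Rightarrow> real"
  assumes "finite I" "card I \<ge> 2" "(\<Sum>j\<in>I. y j) = 0"
  defines "n \<equiv> real (card I)" and "Q \<equiv> \<Sum>j\<in>I. (y j)\<^sup>2"
  shows "(\<Sum>j\<in>I. (y j) ^ 3) \<le> sqrt ((n - 1) / n * Q) * Q * ((n - 2) / (n - 1))"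
proof -
  define m where "m = sqrt ((n - 1) / n * Q)"
  define c where "c = m / (n - 1)"
  have n: "n \<ge> 2" using assms(2) by (simp add: n_def)
  have Q: "Q \<ge> 0" by (simp add: Q_def sum_nonneg)
  have m2: "m\<^sup>2 = (n - 1) / n * Q" using n Q by (simp add: m_def)
  have le: "y j \<le> m" if "j \<in> I" for j
  proof -
    have "n * (y j)\<^sup>2 \<le> (n - 1) * Q"
      using centred_coordinate_bound[OF assms(1) that assms(3)] by (simp add: n_def Q_def)
    then have "(y j)\<^sup>2 \<le> (n - 1) / n * Q" using n by (simp add: field_simps)
    then show ?thesis unfolding m_def by (rule real_le_rsqrt)
  qed
  have "0 \<le> (\<Sum>j\<in>I. (m - y j) * (y j + c)\<^sup>2)"
    using le by (intro sum_nonneg) simp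
  also have "\<dots> = (\<Sum>j\<in>I. (m - 2 * c) * (y j)\<^sup>2 + (2 * c * m - c\<^sup>2) * y j + m * c\<^sup>2 - (y j) ^ 3)"
    by (intro sum.cong) (auto simp: power2_eq_square power3_eq_cube algebra_simps)
  also have "\<dots> = (m - 2 * c) * Q + n * m * c\<^sup>2 - (\<Sum>j\<in>I. (y j) ^ 3)"
    using assms(3) by (simp add: sum.distrib sum_subtractf Q_def n_def flip: sum_distrib_left)
  finally have "(\<Sum>j\<in>I. (y j) ^ 3) \<le> (m - 2 * c) * Q + n * m * c\<^sup>2" by simp
  also have "n * m * c\<^sup>2 = n * m * (m\<^sup>2 / (n - 1)\<^sup>2)" by (simp add: c_def power_divide)
  also have "\<dots> = m * Q / (n - 1)"
  proof -
    \<comment> \<open>Abstracting \<open>n - 1\<close> to a nonzero \<open>d\<close> lets the field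
      simplification treat it as an atom.\<close>
    have "n * m * (d / n * Q / d\<^sup>2) = m * Q / d" if "d \<noteq> 0" for d
      using that n by (simp add: field_simps power2_eq_square)
    then show ?thesis unfolding m2 using n by simp
  qed
  also have "(m - 2 * c) * Q + m * Q / (n - 1) = m * Q * ((n - 2) / (n - 1))"
  proof -
    have "(m - 2 * (m / d)) * Q + m * Q / d = m * Q * ((d - 1) / d)" if "d \<noteq> 0" for d
      using that by (simp add: field_simps)
    from this[of "n - 1"] show ?thesis using n by (simp add: c_def)
  qed
  finally show ?thesis by (simp add: m_def)
qed

text \<open>The sum of cubes is odd in \<open>y\<close>, so the one-sided bound applied to
  \<open>y\<close> and \<open>- y\<close> controls its absolute value; squaring removes the
  root.\<close>

lemma centred_cube_sum_square_le:
  fixes y :: "'n \<Rightarrow> real"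
  assumes "finite I" "card I \<ge> 2" "(\<Sum>j\<in>I. y j) = 0"
  defines "n \<equiv> real (card I)" and "Q \<equiv> \<Sum>j\<in>I. (y j)\<^sup>2"
  shows "(\<Sum>j\<in>I. (y j) ^ 3)\<^sup>2 \<le> (n - 2)\<^sup>2 / (n * (n - 1)) * Q ^ 3"
proof -
  let ?R = "sqrt ((n - 1) / n * Q) * Q * ((n - 2) / (n - 1))"
  have n: "n \<ge> 2" using assms(2) by (simp add: n_def)
  have Q: "Q \<ge> 0" by (simp add: Q_def sum_nonneg)
  have "(\<Sum>j\<in>I. (y j) ^ 3) \<le> ?R"
    using centred_cube_sum_le[OF assms(1-3)] by (simp add: n_def Q_def)
  moreover have "(\<Sum>j\<in>I. (- y j) ^ 3) \<le> ?R"
    using centred_cube_sum_le[of I "\<lambda>j. - y j"] assms(1-3) by (simp add: n_def Q_def sum_negf)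
  ultimately have "\<bar>\<Sum>j\<in>I. (y j) ^ 3\<bar> \<le> ?R" by (simp add: sum_negf)
  then have "(\<Sum>j\<in>I. (y j) ^ 3)\<^sup>2 \<le> ?R\<^sup>2" by (metis abs_ge_zero power2_abs power_mono)
  also have "\<dots> = ((n - 1) / n * Q) * Q\<^sup>2 * ((n - 2)\<^sup>2 / (n - 1)\<^sup>2)"
    using n Q by (simp add: power_mult_distrib power_divide)
  also have "\<dots> = (n - 2)\<^sup>2 / (n * (n - 1)) * Q ^ 3"
  proof -
    have "(d / n * Q) * Q\<^sup>2 * (e / d\<^sup>2) = e / (n * d) * Q ^ 3" if "d \<noteq> 0" for d e
      using that n by (simp add: field_simps power2_eq_square power3_eq_cube)
    then show ?thesis using n by simp
  qed
  finally show ?thesis .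
qed

section \<open>Restriction to lines in the diagonal direction\<close>

lemma only_real_roots_shifted_cubic:
  fixes q :: "real poly"
  assumes "A \<noteq> 0" "\<And>t. poly q t = A * ((t + s) ^ 3 + b * (t + s) + c)"
  shows "only_real_roots q \<longleftrightarrow> 4 * b ^ 3 + 27 * c\<^sup>2 \<le> 0"
proof -
  \<comment> \<open>The assumption concerns real arguments only; fixing the coefficients carries the
    identity over to complex ones.\<close>
  have q: "q = [:A * (s ^ 3 + b * s + c), A * (3 * s\<^sup>2 + b), 3 * A * s, A:]"
    by (rule poly_ext) (simp add: assms(2) power2_eq_square power3_eq_cube algebra_simps)
  have "poly (map_poly complex_of_real q) z = A * ((z + s) ^ 3 + b * (z + s) + c)" for z :: complex
    by (simp add: q map_poly_pCons power2_eq_square power3_eq_cube algebra_simps)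
  then have "only_real_roots q \<longleftrightarrow> (\<forall>z::complex. (z + s) ^ 3 + b * (z + s) + c = 0 \<longrightarrow> z \<in> \<real>)"
    using assms(1) by (simp add: only_real_roots_def)
  also have "\<dots> \<longleftrightarrow> (\<forall>z::complex. z ^ 3 + b * z + c = 0 \<longrightarrow> z \<in> \<real>)"
  proof (intro iffI allI impI)
    fix z :: complex
    assume "\<forall>z::complex. (z + s) ^ 3 + b * (z + s) + c = 0 \<longrightarrow> z \<in> \<real>" "z ^ 3 + b * z + c = 0"
    then have "z - s \<in> \<real>" by simp
    then show "z \<in> \<real>" using Reals_add[of "z - s" "of_real s"] by simp
  next
    fix z :: complex
    assume "\<forall>z::complex. z ^ 3 + b * z + c = 0 \<longrightarrow> z \<in> \<real>" "(z + s) ^ 3 + b * (z + s) + c = 0"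
    then have "z + s \<in> \<real>" by blast
    then show "z \<in> \<real>" using Reals_diff[of "z + s" "of_real s"] by simp
  qed
  finally show ?thesis by (simp add: depressed_cubic_real_roots_iff)
qed

text \<open>The orthogonal projection onto the hyperplane of coordinate sum 0, unchanged by adding
  multiples of \<open>ones\<close>.\<close>

definition centre :: "real ^ 'n \<Rightarrow> 'n::finite \<Rightarrow> real"
  where "centre x i = x $ i - (\<Sum>j\<in>UNIV. x $ j) / CARD('n)"

lemma sum_centre: "(\<Sum>i\<in>UNIV. centre x i) = 0"
  by (simp add: centre_def sum_subtractf)

text \<open>The quantifier order matters: \<open>b\<close> and \<open>c\<close> depend on
  \<open>p\<close> alone, so information at one \<open>x\<close> constrains all others.\<close>

proposition symmetric_cubic_real_roots_iff:
  fixes p :: "('n::finite, real) mpoly"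
  assumes "homogeneous_mpoly 3 p" "symmetric_mpoly p" "mpoly_eval p ones \<noteq> 0"
  obtains b c where
    "\<And>x. only_real_roots (line_poly p x ones) \<longleftrightarrow>
      4 * (b * (\<Sum>i\<in>UNIV. (centre x i)\<^sup>2)) ^ 3 + 27 * (c * (\<Sum>i\<in>UNIV. (centre x i) ^ 3))\<^sup>2 \<le> 0"
proof -
  obtain \<alpha> \<beta> \<gamma> where ev: "\<And>x. mpoly_eval p x = \<alpha> * (\<Sum>i\<in>UNIV. x $ i) ^ 3
      + \<beta> * (\<Sum>i\<in>UNIV. x $ i) * (\<Sum>i\<in>UNIV. (x $ i)\<^sup>2) + \<gamma> * (\<Sum>i\<in>UNIV. (x $ i) ^ 3)"
    by (rule symmetric_cubic_power_sums[OF assms(1,2)]) blast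
  define n where "n = real CARD('n)"
  define A where "A = mpoly_eval p ones"
  have A: "A = \<alpha> * n ^ 3 + \<beta> * n\<^sup>2 + \<gamma> * n"
    by (simp add: A_def ev ones_def n_def power2_eq_square)
  \<comment> \<open>\<open>A\<close> is the leading coefficient in \<open>t\<close>. The linear
    coefficient collects \<open>\<beta> * n\<close> from the product of the first two power sums and
    \<open>3 * \<gamma>\<close> from the third.\<close>
  define b where "b = (\<beta> * n + 3 * \<gamma>) / A"
  define c where "c = \<gamma> / A"
  have "only_real_roots (line_poly p x ones) \<longleftrightarrow>
      4 * (b * (\<Sum>i\<in>UNIV. (centre x i)\<^sup>2)) ^ 3 + 27 * (c * (\<Sum>i\<in>UNIV. (centre x i) ^ 3))\<^sup>2 \<le> 0" for x
  proof (rule only_real_roots_shifted_cubic)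
    show "A \<noteq> 0" using assms(3) by (simp add: A_def)
    define s where "s = (\<Sum>j\<in>UNIV. x $ j) / CARD('n)"
    let ?Q2 = "\<Sum>i\<in>UNIV. (centre x i)\<^sup>2" and ?Q3 = "\<Sum>i\<in>UNIV. (centre x i) ^ 3"
    fix t
    define T where "T = t + s"
    have coord: "(x + t *\<^sub>R ones) $ i = T + centre x i" for i
      by (simp add: T_def centre_def s_def ones_def)
    have P1: "(\<Sum>i\<in>UNIV. (x + t *\<^sub>R ones) $ i) = n * T"
      by (simp only: coord sum.distrib sum_centre) (simp add: n_def)
    have "(\<Sum>i\<in>UNIV. ((x + t *\<^sub>R ones) $ i)\<^sup>2) = (\<Sum>i\<in>UNIV. T\<^sup>2 + 2 * T * centre x i + (centre x i)\<^sup>2)"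
      by (intro sum.cong refl) (simp only: coord, simp add: power2_eq_square algebra_simps)
    then have P2: "(\<Sum>i\<in>UNIV. ((x + t *\<^sub>R ones) $ i)\<^sup>2) = n * T\<^sup>2 + ?Q2"
      by (simp add: sum.distrib sum_centre n_def flip: sum_distrib_left)
    have "(\<Sum>i\<in>UNIV. ((x + t *\<^sub>R ones) $ i) ^ 3)
        = (\<Sum>i\<in>UNIV. T ^ 3 + 3 * T\<^sup>2 * centre x i + 3 * T * (centre x i)\<^sup>2 + (centre x i) ^ 3)"
      by (intro sum.cong refl) (simp only: coord, simp add: power2_eq_square power3_eq_cube algebra_simps)
    then have P3: "(\<Sum>i\<in>UNIV. ((x + t *\<^sub>R ones) $ i) ^ 3) = n * T ^ 3 + 3 * T * ?Q2 + ?Q3"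
      by (simp add: sum.distrib sum_centre n_def flip: sum_distrib_left)
    have "poly (line_poly p x ones) t = A * T ^ 3 + (\<beta> * n + 3 * \<gamma>) * ?Q2 * T + \<gamma> * ?Q3"
      unfolding poly_line_poly ev P1 P2 P3 A
      by (simp add: power2_eq_square power3_eq_cube algebra_simps)
    also have "\<dots> = A * (T ^ 3 + b * ?Q2 * T + c * ?Q3)"
      using \<open>A \<noteq> 0\<close> by (simp add: b_def c_def field_simps)
    finally show "poly (line_poly p x ones) t = A * ((t + s) ^ 3 + b * ?Q2 * (t + s) + c * ?Q3)"
      by (simp add: T_def)
  qed
  then show thesis using that by blast
qed

section \<open>Coordinate vectors as the extremal case\<close>

lemma centre_axis_power_sum:
  fixes i :: "'n::finite"
  defines "n \<equiv> real CARD('n)"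
  shows "(\<Sum>j\<in>UNIV. (centre (axis i 1) j) ^ k) = (1 - 1 / n) ^ k + (n - 1) * (- 1 / n) ^ k"
proof -
  have "(\<Sum>j\<in>UNIV. (axis i 1 :: real ^ 'n) $ j) = 1"
    by (simp add: axis_def)
  then have "centre (axis i 1) j = (if j = i then 1 - 1 / n else - 1 / n)" for j
    by (simp add: centre_def n_def axis_def)
  then have "(\<Sum>j\<in>UNIV. (centre (axis i 1) j) ^ k)
      = (\<Sum>j\<in>UNIV. (if j = i then (1 - 1 / n) ^ k - (- 1 / n) ^ k else 0) + (- 1 / n) ^ k)"
    by (intro sum.cong) auto
  then show ?thesis
    by (simp only: sum.distrib) (simp add: n_def algebra_simps)
qed

theorem corollary1p9:
  fixes p :: "('n::finite, real) mpoly" and u :: "real ^ 'n"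
  assumes "homogeneous_mpoly 3 p"
    and "symmetric_mpoly p"
    and "mpoly_eval p ones \<noteq> 0"
    and "\<exists>i. u = axis i 1"
  shows "symmetric_hyperbolic p \<longleftrightarrow> only_real_roots (line_poly p u ones)"
proof
  assume "symmetric_hyperbolic p"
  then show "only_real_roots (line_poly p u ones)"
    by (simp add: symmetric_hyperbolic_def hyperbolic_def)
next
  assume real: "only_real_roots (line_poly p u ones)"
  obtain b c where iff: "\<And>x. only_real_roots (line_poly p x ones) \<longleftrightarrow>
      4 * (b * (\<Sum>i\<in>UNIV. (centre x i)\<^sup>2)) ^ 3 + 27 * (c * (\<Sum>i\<in>UNIV. (centre x i) ^ 3))\<^sup>2 \<le> 0"
    by (rule symmetric_cubic_real_roots_iff[OF assms(1-3)]) blast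
  obtain i where u: "u = axis i 1" using assms(4) by blast
  have "only_real_roots (line_poly p x ones)" for x
  proof (cases "CARD('n) \<ge> 2")
    \<comment> \<open>In one variable every centred vector is 0 and the condition reads 0 \<le> 0;
      the ratio bound divides by \<open>n - 1\<close>.\<close>
    case False
    then have "CARD('n) = 1" using zero_less_card_finite[where 'a='n] by linarith
    then obtain a :: 'n where a: "UNIV = {a}" by (metis card_1_singletonE)
    have "centre x a = 0" using sum_centre[of x] unfolding a by simp
    moreover have "j = a" for j using a by (metis UNIV_I singletonD)
    ultimately have "centre x j = 0" for j by metis
    then show ?thesis by (simp add: iff)
  next
    case True
    define n where "n = real CARD('n)"
    have n: "n \<ge> 2" using True by (simp add: n_def)
    \<comment> \<open>The largest ratio of \<open>(?Q3 x)\<^sup>2\<close> to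
      \<open>(?Q2 x) ^ 3\<close>: a bound by \<open>centred_cube_sum_square_le\<close>, attained at
      \<open>u\<close>.\<close>
    define R where "R = (n - 2)\<^sup>2 / (n * (n - 1))"
    let ?Q2 = "\<lambda>x::real^'n. \<Sum>i\<in>UNIV. (centre x i)\<^sup>2" and ?Q3 = "\<lambda>x::real^'n. \<Sum>i\<in>UNIV. (centre x i) ^ 3"
    have Q2u: "?Q2 u = (n - 1) / n"
      using n unfolding u centre_axis_power_sum n_def[symmetric]
      by (simp add: field_simps power2_eq_square)
    have Q3u: "?Q3 u = (n - 1) * (n - 2) / n\<^sup>2"
      using n unfolding u centre_axis_power_sum n_def[symmetric]
      by (simp add: field_simps power2_eq_square power3_eq_cube)
    have "(d * e / n\<^sup>2)\<^sup>2 = e\<^sup>2 / (n * d) * (d / n) ^ 3" if "d \<noteq> 0" for d e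
      using that n by (simp add: field_simps power2_eq_square power3_eq_cube)
    then have "(?Q3 u)\<^sup>2 = R * (?Q2 u) ^ 3"
      unfolding Q2u Q3u R_def using n by simp
    \<comment> \<open>Equality at \<open>u\<close> turns its condition into a multiple of the
      positive \<open>(?Q2 u) ^ 3\<close>, isolating an inequality free of \<open>x\<close>.\<close>
    then have "(4 * b ^ 3 + 27 * c\<^sup>2 * R) * (?Q2 u) ^ 3 \<le> 0"
      using real unfolding iff by (simp add: algebra_simps power_mult_distrib)
    moreover have "(?Q2 u) ^ 3 > 0" using n by (simp add: Q2u)
    ultimately have bc: "4 * b ^ 3 + 27 * c\<^sup>2 * R \<le> 0"
      by (simp add: mult_le_0_iff)
    have "(?Q3 x)\<^sup>2 \<le> R * (?Q2 x) ^ 3"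
      using centred_cube_sum_square_le[OF _ True sum_centre] by (simp add: R_def n_def)
    \<comment> \<open>As \<open>27 * c\<^sup>2\<close> is nonnegative, the ratio bound may replace
      \<open>(?Q3 x)\<^sup>2\<close>; what results is the bracket from \<open>bc\<close> times a
      nonnegative cube.\<close>
    then have "4 * (b * ?Q2 x) ^ 3 + 27 * (c * ?Q3 x)\<^sup>2 \<le> 4 * (b * ?Q2 x) ^ 3 + 27 * c\<^sup>2 * (R * (?Q2 x) ^ 3)"
      by (simp add: power_mult_distrib mult_left_mono)
    also have "\<dots> = (4 * b ^ 3 + 27 * c\<^sup>2 * R) * (?Q2 x) ^ 3"
      by (simp add: algebra_simps power_mult_distrib)
    also have "\<dots> \<le> 0"
      using bc by (intro mult_nonpos_nonneg) (auto intro: sum_nonneg)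
    finally show ?thesis by (simp add: iff)
  qed
  then show "symmetric_hyperbolic p"
    using assms by (auto simp: symmetric_hyperbolic_def hyperbolic_def)
qed

end
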